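(* Let $n\ge 3$. The identifiability degree of the $n$-compartment cycle model with input, output, and leak in compartment $1$ only is $(n-1)!$.
   Context: A linear compartmental model $(G,In,Out,Leak)$ consists of a finite directed graph $G=(V,E)$ with $V=\{1,\dots,n\}$ and subsets $In,Out,Leak\subseteq V$. Each edge $i\to j$ carries a parameter $a_{ji}$ and each leak $i\in Leak$ a parameter $a_{0i}$ (independent real variables). The compartmental matrix is the $n\times n$ matrix $A$ with $A_{ij}=a_{ij}$ if $i\ne j$ and $j\to i$ is an edge, $A_{ij}=0$ if $i\ne j$ and $j\to i$ is not an edge, and $A_{ii}=-\sum_{k:\,i\to k\in E}a_{ki}$, with an additional summand $-a_{0i}$ if $i\in Leak$. The $n$-compartment cycle model has edges $1\to2\to3\to\cdots\to n\to1$ (parameters $a_{21},a_{32},\dots,a_{n,n-1},a_{1,n}$), no other edges, and $In=Out=Leak=\{1\}$ (leak parameter $a_{01}$); it has $n+1$ parameters. For $In=Out=\{1\}$, write $\det(\lambda I-A)=\lambda^n+c_{n-1}\lambda^{n-1}+\dots+c_0$ and $\det((\lambda I-A)_{11})=\lambda^{n-1}+d_{n-2}\lambda^{n-2}+\dots+d_0$, where $(\cdot)_{11}$ means removing row 1 and column 1. The coefficient map is the polynomial map $c=(c_0,\dots,c_{n-1},d_0,\dots,d_{n-2}):\mathbb{R}^{|E|+|Leak|}\to\mathbb{R}^{2n-1}$. The identifiability degree of a (generically locally identifiable) model is $m$ if the coefficient map is generically $m$-to-1, i.e. for all parameter points $p\in\mathbb{R}^{|E|+|Leak|}$ outside a set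 of measure zero, the fiber $c^{-1}(c(p))$ has exactly $m$ elements. *)

theory Defs
  imports
    "HOL-Analysis.Lebesgue_Measure"
    "Jordan_Normal_Form.Char_Poly"
begin

text \<open>A linear compartmental model \<open>(G, In, Out, Leak)\<close> with vertex set \<open>{1..n}\<close>.
  A pair \<open>(i, j)\<close> in \<open>edges\<close> stands for the edge \<open>i \<rightarrow> j\<close>; self-loops are excluded
  by \<open>valid_model\<close> below.\<close>

record compartmental_model =
  num_comps :: nat
  edges :: "(nat \<times> nat) set"
  inputs :: "nat set"
  outputs :: "nat set"
  leaks :: "nat set"

definition valid_model :: "compartmental_model \<Rightarrow> bool" where
  "valid_model M \<longleftrightarrow>
     edges M \<subseteq> {1..num_comps M} \<times> {1..num_comps M} \<and> irrefl (edges M) \<and>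
     inputs M \<subseteq> {1..num_comps M} \<and> outputs M \<subseteq> {1..num_comps M} \<and>
     leaks M \<subseteq> {1..num_comps M}"

text \<open>Parameters are indexed as in \<open>a\<^sub>j\<^sub>i\<close>, target first: the edge \<open>i \<rightarrow> j\<close> has index \<open>(j, i)\<close>
  and the leak at \<open>i\<close> has index \<open>(0, i)\<close>. There is no clash, as \<open>0\<close> is not a vertex.\<close>

definition param_index :: "compartmental_model \<Rightarrow> (nat \<times> nat) set" where
  "param_index M = {(j, i) | i j. (i, j) \<in> edges M} \<union> {(0, i) | i. i \<in> leaks M}"

text \<open>The parameter space \<open>\<real>\<^bsup>|E| + |Leak|\<^esup>\<close> is \<open>param_index M \<rightarrow>\<^sub>E UNIV\<close>, carrying the
  product of the one-dimensional Lebesgue measures. The measure lives on the Borel sets, but almost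
  everywhere only asks the exceptional set to be contained in a null set, so this is the
  usual notion of measure zero.\<close>

definition param_measure :: "compartmental_model \<Rightarrow> (nat \<times> nat \<Rightarrow> real) measure" where
  "param_measure M = (\<Pi>\<^sub>M x\<in>param_index M. lborel)"

definition compartmental_entry ::
    "compartmental_model \<Rightarrow> (nat \<times> nat \<Rightarrow> real) \<Rightarrow> nat \<Rightarrow> nat \<Rightarrow> real" where
  "compartmental_entry M a i j =
     (if i \<noteq> j then (if (j, i) \<in> edges M then a (i, j) else 0)
      else - (\<Sum>k | (i, k) \<in> edges M. a (k, i)) - (if i \<in> leaks M then a (0, i) else 0))"

text \<open>Matrices are indexed from \<open>0\<close>, compartments from \<open>1\<close>.\<close>

definition compartmental_matrix ::
    "compartmental_model \<Rightarrow> (nat \<times> nat \<Rightarrow> real) \<Rightarrow> real mat" where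
  "compartmental_matrix M a =
     mat (num_comps M) (num_comps M) (\<lambda>(i, j). compartmental_entry M a (Suc i) (Suc j))"

text \<open>The coefficient map \<open>(c\<^sub>0, \<dots>, c\<^bsub>n-1\<^esub>, d\<^sub>0, \<dots>, d\<^bsub>n-2\<^esub>)\<close> of a model with
  \<open>In = Out = {1}\<close>. The polynomial matrix \<open>char_poly_matrix A\<close> is \<open>\<lambda>I - A\<close>, and \<open>char_poly A\<close> is its
  determinant.\<close>

definition coefficient_map ::
    "compartmental_model \<Rightarrow> (nat \<times> nat \<Rightarrow> real) \<Rightarrow> real vec" where
  "coefficient_map M a =
     (let n = num_comps M; A = compartmental_matrix M a in
      vec n (coeff (char_poly A)) @\<^sub>v
      vec (n - 1) (coeff (det (mat_delete (char_poly_matrix A) 0 0))))"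

text \<open>Finiteness of the fibre is explicit because \<open>card\<close> is \<open>0\<close> on infinite sets. The condition on
  inputs and outputs restricts the notion to the models covered by \<open>coefficient_map\<close>.\<close>

definition has_identifiability_degree :: "compartmental_model \<Rightarrow> nat \<Rightarrow> bool" where
  "has_identifiability_degree M m \<longleftrightarrow>
     valid_model M \<and> inputs M = {1} \<and> outputs M = {1} \<and>
     (AE p in param_measure M.
        let fibre = {q \<in> param_index M \<rightarrow>\<^sub>E UNIV. coefficient_map M q = coefficient_map M p}
        in finite fibre \<and> card fibre = m)"

definition cycle_model :: "nat \<Rightarrow> compartmental_model" where
  "cycle_model n =
     \<lparr>num_comps = n,
      edges = {(i, Suc i) | i. 1 \<le> i \<and> i < n} \<union> {(n, 1)},
      inputs = {1}, outputs = {1}, leaks = {1}\<rparr>"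

end

theory Submission
  imports Defs "HOL-Combinatorics.Permutations"
begin

text \<open>Write \<open>k\<^sub>i\<close> for the parameter of the edge leaving \<open>i\<close> and \<open>l\<close> for the leak parameter. The minor has
  determinant \<open>D = (\<lambda> + k\<^sub>2) \<cdots> (\<lambda> + k\<^sub>n)\<close>, and the characteristic polynomial is
  \<open>(\<lambda> + k\<^sub>1 + l) D - k\<^sub>1 k\<^sub>2 \<cdots> k\<^sub>n\<close>. So the coefficients determine exactly the multiset
  \<open>{k\<^sub>2, \<dots>, k\<^sub>n}\<close>, the sum \<open>k\<^sub>1 + l\<close> and the product \<open>k\<^sub>1 k\<^sub>2 \<cdots> k\<^sub>n\<close>. If \<open>k\<^sub>2, \<dots>, k\<^sub>n\<close> are distinct and
  nonzero, which holds off finitely many hyperplanes, then \<open>k\<^sub>1\<close> and \<open>l\<close> are determined and the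
  fibre consists of the \<open>(n - 1)!\<close> rearrangements of \<open>k\<^sub>2, \<dots>, k\<^sub>n\<close>.\<close>

section \<open>Null sets in the parameter space\<close>

text \<open>Fubini, integrating the coordinate \<open>x\<close> first: since \<open>f\<close>
  ignores that coordinate, the slice of the exceptional set lies in the single point
  \<open>f p\<close>, which has length 0.\<close>

lemma AE_component_neq:
  fixes f :: "('i \<Rightarrow> real) \<Rightarrow> real"
  assumes "finite I" "x \<in> I" and [measurable]: "f \<in> borel_measurable (\<Pi>\<^sub>M i\<in>I. lborel)"
    and indep: "\<And>p v. f (p(x := v)) = f p"
  shows "AE p in (\<Pi>\<^sub>M i\<in>I. lborel). p x \<noteq> f p"
proof -
  interpret product_sigma_finite "\<lambda>i::'i. lborel :: real measure" ..
  define J where "J = I - {x}"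
  have I: "I = insert x J" and J: "finite J" "x \<notin> J"
    using assms(1,2) by (auto simp: J_def)
  let ?M = "\<Pi>\<^sub>M i\<in>I. (lborel :: real measure)"
  let ?N = "{p \<in> space ?M. p x = f p}"
  have [measurable]: "(\<lambda>p. p x) \<in> borel_measurable ?M"
    using measurable_component_singleton[OF \<open>x \<in> I\<close>, of "\<lambda>i. lborel"] by simp
  have N[measurable]: "?N \<in> sets ?M" by measurable
  have "emeasure ?M ?N = (\<integral>\<^sup>+ p. indicator ?N p \<partial>?M)"
    using N by simp
  also have "\<dots> = (\<integral>\<^sup>+ p. (\<integral>\<^sup>+ y. indicator ?N (p(x := y)) \<partial>lborel) \<partial>(\<Pi>\<^sub>M i\<in>J. lborel))"
    using N product_nn_integral_insert[OF J, of "indicator ?N"] by (simp flip: I)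
  also have "\<dots> \<le> (\<integral>\<^sup>+ p. (\<integral>\<^sup>+ y. indicator {f p} y \<partial>lborel) \<partial>(\<Pi>\<^sub>M i\<in>J. lborel))"
    by (intro nn_integral_mono) (auto simp: indep indicator_def)
  also have "\<dots> = 0" by simp
  finally have "?N \<in> null_sets ?M" using N by auto
  then show ?thesis by (rule AE_I') auto
qed

section \<open>Counting points up to rearrangement\<close>

text \<open>The roots of each product are the negated values, so both functions have the same image.
  As \<open>p\<close> is injective, counting makes \<open>q\<close> injective too, so all
  multiplicities are 1 and the multisets of values agree.\<close>

lemma prod_linear_poly_eq_permutes:
  fixes p q :: "'i \<Rightarrow> real"
  assumes "finite T" "inj_on p T"
    and eq: "(\<Prod>x\<in>T. [:q x, 1:]) = (\<Prod>x\<in>T. [:p x, 1:])"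
  obtains \<pi> where "\<pi> permutes T" "\<And>x. x \<in> T \<Longrightarrow> q x = p (\<pi> x)"
proof -
  have roots: "r ` T = {y. poly (\<Prod>x\<in>T. [:r x, 1:]) (- y) = 0}" for r :: "'i \<Rightarrow> real"
    using \<open>finite T\<close> by (auto simp: poly_prod)
  have im: "q ` T = p ` T" unfolding roots eq ..
  then have "card (q ` T) = card T" using assms(2) by (simp add: card_image)
  then have "inj_on q T" using \<open>finite T\<close> by (simp add: eq_card_imp_inj_on)
  then have "image_mset q (mset_set T) = image_mset p (mset_set T)"
    using assms(2) im by (simp add: image_mset_mset_set)
  from image_mset_eq_implies_permutes[OF \<open>finite T\<close> this] that show ?thesis by metis
qed

text \<open>Here \<open>u\<close> stands for the edge leaving compartment 1, \<open>v\<close> for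
  the leak and \<open>T\<close> for the other edges. The map
  \<open>\<pi> \<mapsto> p \<circ> \<pi>\<close> is a bijection from the permutations of
  \<open>T\<close> onto \<open>F\<close>.\<close>

lemma card_fibre:
  fixes p :: "'i \<Rightarrow> real"
  assumes T: "finite T" and uv: "u \<noteq> v" "u \<notin> T" "v \<notin> T" and I: "I = insert u (insert v T)"
    and inj: "inj_on p T" and nz: "(\<Prod>x\<in>T. p x) \<noteq> 0"
  defines "F \<equiv> {q \<in> I \<rightarrow>\<^sub>E UNIV. (\<Prod>x\<in>T. [:q x, 1:]) = (\<Prod>x\<in>T. [:p x, 1:]) \<and>
    q u + q v = p u + p v \<and> q u * (\<Prod>x\<in>T. q x) = p u * (\<Prod>x\<in>T. p x)}"
  shows "finite F \<and> card F = fact (card T)"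
proof -
  let ?P = "{\<pi>. \<pi> permutes T}"
  \<comment> \<open>Points of \<open>I \<rightarrow>\<^sub>E UNIV\<close> are
    \<open>undefined\<close> off \<open>I\<close>, hence the restriction.\<close>
  let ?h = "\<lambda>\<pi>. restrict (p \<circ> \<pi>) I"
  have fix_uv: "\<pi> u = u" "\<pi> v = v" if "\<pi> permutes T" for \<pi>
    using that uv by (auto simp: permutes_def)
  have in_T: "\<pi> x \<in> T \<longleftrightarrow> x \<in> T" if "\<pi> permutes T" for \<pi> x
    using that by (rule permutes_in_image)
  have "inj_on ?h ?P"
  proof (rule inj_onI)
    fix \<pi> \<sigma> assume *: "\<pi> \<in> ?P" "\<sigma> \<in> ?P" "?h \<pi> = ?h \<sigma>"
    show "\<pi> = \<sigma>"
    proof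
      fix x show "\<pi> x = \<sigma> x"
      proof (cases "x \<in> T")
        case True
        then have "p (\<pi> x) = p (\<sigma> x)" using fun_cong[OF *(3), of x] by (simp add: I)
        then show ?thesis using inj True * in_T by (auto dest: inj_onD)
      next
        case False
        then show ?thesis using * by (auto simp: permutes_def)
      qed
    qed
  qed
  moreover have "?h ` ?P = F"
  proof (intro equalityI subsetI)
    fix q assume "q \<in> ?h ` ?P"
    then obtain \<pi> where \<pi>: "\<pi> permutes T" and q: "q = ?h \<pi>" by auto
    \<comment> \<open>The codomain is left general to cover both the product of linear polynomials
      and that of real values.\<close>
    have perm: "(\<Prod>x\<in>T. g (q x)) = (\<Prod>x\<in>T. g (p x))" for g :: "real \<Rightarrow> 'b :: comm_monoid_mult"
    proof -
      have "(\<Prod>x\<in>T. g (q x)) = (\<Prod>x\<in>T. ((\<lambda>x. g (p x)) \<circ> \<pi>) x)"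
        by (rule prod.cong) (auto simp: q I)
      also have "\<dots> = (\<Prod>x\<in>T. g (p x))"
        using prod.permute[OF \<pi>, of "\<lambda>x. g (p x)"] by simp
      finally show ?thesis .
    qed
    show "q \<in> F"
      using perm[of "\<lambda>y. [:y, 1:]"] perm[of "\<lambda>y. y"] fix_uv[OF \<pi>] unfolding F_def
      by (auto simp: q I)
  next
    fix q assume q: "q \<in> F"
    then have D: "(\<Prod>x\<in>T. [:q x, 1:]) = (\<Prod>x\<in>T. [:p x, 1:])" by (simp add: F_def)
    obtain \<pi> where \<pi>: "\<pi> permutes T" "\<And>x. x \<in> T \<Longrightarrow> q x = p (\<pi> x)"
      using prod_linear_poly_eq_permutes[OF T inj D] by metis
    \<comment> \<open>Constant terms agree; cancelling this nonzero product then gives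
      \<open>q u = p u\<close>, and the sum gives \<open>q v = p v\<close>.\<close>
    have "(\<Prod>x\<in>T. q x) = (\<Prod>x\<in>T. p x)"
      using arg_cong[OF D, of "\<lambda>r. poly r 0"] by (simp add: poly_prod)
    with q nz have "q u = p u" "q v = p v" by (auto simp: F_def)
    with \<pi> fix_uv[OF \<pi>(1)] q have "q = ?h \<pi>"
      by (intro ext) (auto simp: F_def I PiE_def extensional_def)
    with \<pi>(1) show "q \<in> ?h ` ?P" by blast
  qed
  ultimately have "bij_betw ?h ?P F" by (simp add: bij_betw_def)
  then show ?thesis
    using card_permutations[OF refl T] finite_permutations[OF T]
    by (metis bij_betw_finite bij_betw_same_card)
qed

section \<open>Recovering polynomials from coefficients\<close>

text \<open>The coefficient map omits the leading 1; monicity and the degree supply the coefficients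
  from \<open>n\<close> on.\<close>

lemma monic_poly_eqI:
  fixes p q :: "'a :: comm_ring_1 poly"
  assumes "degree p = n" "coeff p n = 1" "degree q = n" "coeff q n = 1"
    and "vec n (coeff p) = vec n (coeff q)"
  shows "p = q"
proof (rule poly_eqI)
  fix i
  consider "i < n" | "i = n" | "i > n" by linarith
  then show "coeff p i = coeff q i"
  proof cases
    case 1
    then show ?thesis using arg_cong[OF assms(5), of "\<lambda>w. w $ i"] by simp
  qed (use assms in \<open>auto simp: coeff_eq_0\<close>)
qed

lemma prod_linear_poly_monic:
  fixes r :: "'i \<Rightarrow> real"
  assumes "finite T"
  shows "degree (\<Prod>x\<in>T. [:r x, 1:]) = card T" "coeff (\<Prod>x\<in>T. [:r x, 1:]) (card T) = 1"
proof -
  show *: "degree (\<Prod>x\<in>T. [:r x, 1:]) = card T"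
    by (subst degree_prod_sum_eq) auto
  show "coeff (\<Prod>x\<in>T. [:r x, 1:]) (card T) = 1"
    using lead_coeff_prod[of "\<lambda>x. [:r x, 1:]" T] by (simp add: *)
qed

text \<open>Subtracting makes \<open>(s - s') D\<close> constant, which forces \<open>s = s'\<close>
  for nonconstant \<open>D\<close>. This separates the sum and the product hidden in the
  characteristic polynomial.\<close>

lemma linear_mult_minus_const_eq_iff:
  fixes D :: "real poly"
  assumes "degree D > 0"
  shows "[:s, 1:] * D - [:c:] = [:s', 1:] * D - [:c':] \<longleftrightarrow> s = s' \<and> c = c'"
proof
  assume *: "[:s, 1:] * D - [:c:] = [:s', 1:] * D - [:c':]"
  then have eq: "[:s - s':] * D = [:c - c':]"
  proof -
    have "[:s - s':] * D = [:s, 1:] * D - [:s', 1:] * D"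
      by (simp add: smult_diff_left)
    also have "\<dots> = [:c:] - [:c':]"
      using * by (simp only: diff_eq_eq eq_diff_eq add.commute add.left_commute diff_add_eq)
    finally show ?thesis by simp
  qed
  then have "Polynomial.smult (s - s') D = [:c - c':]" by simp
  then have "degree (Polynomial.smult (s - s') D) = 0" by simp
  with assms have "s = s'" by (auto split: if_splits)
  with eq show "s = s' \<and> c = c'" by simp
qed simp

section \<open>The cycle model and its determinants\<close>

definition cycle_target :: "nat \<Rightarrow> nat \<Rightarrow> nat" where
  "cycle_target n i = (if i < n then Suc i else 1)"

text \<open>Each compartment has exactly one outgoing edge, so its source can name the parameter;
  the pair has the target first, as in \<open>param_index\<close>.\<close>

definition cycle_edge :: "nat \<Rightarrow> nat \<Rightarrow> nat \<times> nat" where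
  "cycle_edge n i = (cycle_target n i, i)"

lemma inj_cycle_edge: "inj_on (cycle_edge n) S"
  by (auto simp: inj_on_def cycle_edge_def)

lemma cycle_edges: "n \<ge> 1 \<Longrightarrow> edges (cycle_model n) = (\<lambda>i. (i, cycle_target n i)) ` {1..n}"
  by (force simp: cycle_model_def cycle_target_def)

lemma param_index_cycle:
  assumes "n \<ge> 1"
  shows "param_index (cycle_model n) =
    insert (cycle_edge n 1) (insert (0, 1) (cycle_edge n ` {2..n}))"
proof -
  have "{1..n} = insert 1 {2..n}" using assms by auto
  moreover have "leaks (cycle_model n) = {1}" by (simp add: cycle_model_def)
  ultimately show ?thesis
    using assms by (auto simp: param_index_def cycle_edges cycle_edge_def)
qed

lemma compartmental_entry_cycle:
  assumes "n \<ge> 2" "i \<in> {1..n}" "j \<in> {1..n}"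
  shows "compartmental_entry (cycle_model n) a i j =
    (if i = j then - a (cycle_edge n i) - (if i = 1 then a (0, 1) else 0)
     else if i = cycle_target n j then a (cycle_edge n j) else 0)"
proof -
  have out: "{k. (i, k) \<in> edges (cycle_model n)} = {cycle_target n i}"
    using assms by (auto simp: cycle_edges)
  have edge: "(j, i) \<in> edges (cycle_model n) \<longleftrightarrow> i = cycle_target n j"
    using assms by (auto simp: cycle_edges)
  have leak: "leaks (cycle_model n) = {1}" by (simp add: cycle_model_def)
  show ?thesis
    unfolding compartmental_entry_def out edge leak by (simp add: cycle_edge_def)
qed

lemma compartmental_matrix_carrier:
  "compartmental_matrix (cycle_model n) a \<in> carrier_mat n n"
  by (simp add: compartmental_matrix_def cycle_model_def)

context
  fixes m :: nat and a :: "nat \<times> nat \<Rightarrow> real"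
  assumes m: "m \<ge> 2"
begin

private abbreviation "k \<equiv> \<lambda>i. a (cycle_edge (Suc m) i)"
private abbreviation "B \<equiv> char_poly_matrix (compartmental_matrix (cycle_model (Suc m)) a)"

private lemma B_carrier: "B \<in> carrier_mat (Suc m) (Suc m)"
  by (simp add: compartmental_matrix_carrier)

private lemma B_entry:
  assumes "i \<le> m" "j \<le> m"
  shows "B $$ (i, j) =
    (if i = j then [:k (Suc i) + (if i = 0 then a (0, 1) else 0), 1:]
     else if Suc i = cycle_target (Suc m) (Suc j) then [:- k (Suc j):] else 0)"
proof -
  have "num_comps (cycle_model (Suc m)) = Suc m" by (simp add: cycle_model_def)
  then show ?thesis
    using assms m
    by (auto simp: char_poly_matrix_def compartmental_matrix_def compartmental_entry_cycle)
qed

text \<open>Removing compartment 1 cuts the cycle into a path, whose matrix is lower triangular.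
  Position \<open>i\<close> of the minor belongs to compartment \<open>i + 2\<close>.\<close>

lemma det_minor_cycle: "det (mat_delete B 0 0) = (\<Prod>i\<in>{2..Suc m}. [:k i, 1:])"
proof -
  let ?C = "mat_delete B 0 0"
  have C: "?C \<in> carrier_mat m m"
    using B_carrier by (simp add: mat_delete_def)
  have entry: "?C $$ (i, j) = B $$ (Suc i, Suc j)" if "i < m" "j < m" for i j
    using that B_carrier by (simp add: mat_delete_def)
  have "det ?C = prod_list (diag_mat ?C)"
    by (intro det_lower_triangular[OF _ C]) (auto simp: entry B_entry cycle_target_def)
  also have "\<dots> = (\<Prod>i\<in>{0..<m}. [:k (i + 2), 1:])"
    using carrier_matD(1)[OF C] by (simp add: prod_list_diag_prod entry B_entry)
  also have "\<dots> = (\<Prod>i\<in>{2..Suc m}. [:k i, 1:])"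
    by (intro prod.reindex_bij_witness[of _ "\<lambda>i. i - 2" "\<lambda>i. i + 2"]) auto
  finally show ?thesis .
qed

text \<open>Deleting row 0 and the last column moves the subdiagonal entries \<open>- k i\<close>
  onto the diagonal and the old diagonal above it.\<close>

private lemma det_corner_minor_cycle:
  "det (mat_delete B 0 m) = (- 1) ^ m * [:(\<Prod>i\<in>{1..m}. k i):]"
proof -
  let ?C = "mat_delete B 0 m"
  have C: "?C \<in> carrier_mat m m"
    using B_carrier by (simp add: mat_delete_def)
  have entry: "?C $$ (i, j) = B $$ (Suc i, j)" if "i < m" "j < m" for i j
    using that B_carrier by (simp add: mat_delete_def)
  have "det ?C = prod_list (diag_mat ?C)"
    using carrier_matD(1)[OF C]
    by (intro det_upper_triangular[OF _ C])
      (auto simp: upper_triangular_def entry B_entry cycle_target_def)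
  also have "\<dots> = (\<Prod>i\<in>{0..<m}. [:- k (Suc i):])"
    using carrier_matD(1)[OF C] by (simp add: prod_list_diag_prod entry B_entry cycle_target_def)
  also have "\<dots> = (\<Prod>i\<in>{1..m}. - [:k i:])"
    by (intro prod.reindex_bij_witness[of _ "\<lambda>i. i - 1" Suc]) auto
  also have "\<dots> = (- 1) ^ m * (\<Prod>i\<in>{1..m}. [:k i:])"
    by (simp add: prod_uminus del: minus_pCons)
  also have "(\<Prod>i\<in>{1..m}. [:k i:]) = [:(\<Prod>i\<in>{1..m}. k i):]"
    by (induction rule: infinite_finite_induct) (auto simp: one_pCons)
  finally show ?thesis .
qed

text \<open>Laplace expansion along row 0, whose only nonzero entries can be the diagonal one and
  the one of the closing edge from the last compartment to compartment 1.\<close>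

lemma char_poly_cycle:
  "char_poly (compartmental_matrix (cycle_model (Suc m)) a) =
    [:k 1 + a (0, 1), 1:] * (\<Prod>i\<in>{2..Suc m}. [:k i, 1:]) - [:k 1 * (\<Prod>i\<in>{2..Suc m}. k i):]"
proof -
  let ?D = "\<Prod>i\<in>{2..Suc m}. [:k i, 1:]"
  have "char_poly (compartmental_matrix (cycle_model (Suc m)) a) =
      (\<Sum>j<Suc m. B $$ (0, j) * cofactor B 0 j)"
    unfolding char_poly_def by (intro laplace_expansion_row[OF B_carrier]) simp
  also have "\<dots> = (\<Sum>j\<in>{0, m}. B $$ (0, j) * cofactor B 0 j)"
    by (intro sum.mono_neutral_right) (auto simp: B_entry cycle_target_def)
  also have "\<dots> = B $$ (0, 0) * cofactor B 0 0 + B $$ (0, m) * cofactor B 0 m"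
    using m by simp
  also have "B $$ (0, 0) * cofactor B 0 0 = [:k 1 + a (0, 1), 1:] * ?D"
    unfolding cofactor_def det_minor_cycle by (simp add: B_entry)
  also have "B $$ (0, m) * cofactor B 0 m = - [:k (Suc m) * (\<Prod>i\<in>{1..m}. k i):]"
  proof -
    have "B $$ (0, m) = - [:k (Suc m):]"
      using m by (simp add: B_entry cycle_target_def)
    \<comment> \<open>The cofactor sign \<open>(- 1) ^ (0 + m)\<close> cancels the sign of the
      corner minor.\<close>
    moreover have "cofactor B 0 m = [:\<Prod>i\<in>{1..m}. k i:]"
      unfolding cofactor_def det_corner_minor_cycle by (simp flip: power_mult_distrib mult.assoc)
    ultimately show ?thesis by simp
  qed
  also have "k (Suc m) * (\<Prod>i\<in>{1..m}. k i) = (\<Prod>i\<in>{1..Suc m}. k i)"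
    by (simp add: mult.commute)
  also have "\<dots> = k 1 * (\<Prod>i\<in>{2..Suc m}. k i)"
    using prod.atLeast_Suc_atMost[of 1 "Suc m" k] by (simp add: numeral_2_eq_2)
  finally show ?thesis by simp
qed

end

section \<open>Fibres of the coefficient map and their generic size\<close>

lemma coefficient_map_cycle_eq_iff:
  assumes n: "n \<ge> 3"
  defines "T \<equiv> cycle_edge n ` {2..n}" and "u \<equiv> cycle_edge n 1" and "v \<equiv> (0, 1)"
  shows "coefficient_map (cycle_model n) q = coefficient_map (cycle_model n) p \<longleftrightarrow>
    (\<Prod>x\<in>T. [:q x, 1:]) = (\<Prod>x\<in>T. [:p x, 1:]) \<and>
    q u + q v = p u + p v \<and> q u * (\<Prod>x\<in>T. q x) = p u * (\<Prod>x\<in>T. p x)"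
proof -
  obtain m where n_eq: "n = Suc m" and m: "m \<ge> 2" using n by (cases n) auto
  define D where "D r = (\<Prod>x\<in>T. [:r x, 1:])" for r :: "nat \<times> nat \<Rightarrow> real"
  define C where "C r = char_poly (compartmental_matrix (cycle_model n) r)" for r
  have T: "finite T" "card T = n - 1"
    using n by (auto simp: T_def card_image inj_cycle_edge)
  have reindex: "(\<Prod>i\<in>{2..n}. g (cycle_edge n i)) = (\<Prod>x\<in>T. g x)"
    for g :: "nat \<times> nat \<Rightarrow> 'b :: comm_monoid_mult"
    by (simp add: T_def prod.reindex inj_cycle_edge)
  have C: "C r = [:r u + r v, 1:] * D r - [:r u * (\<Prod>x\<in>T. r x):]" for r
    using char_poly_cycle[OF m, of r, folded n_eq] reindex[of "\<lambda>x. [:r x, 1:]"] reindex[of r]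
    by (simp add: C_def D_def u_def v_def)
  have Dm: "degree (D r) = n - 1" "coeff (D r) (n - 1) = 1" for r
    using prod_linear_poly_monic[OF T(1), of r] T(2) by (auto simp: D_def)
  have Cm: "degree (C r) = n" "coeff (C r) n = 1" for r
    using degree_monic_char_poly[OF compartmental_matrix_carrier] by (auto simp: C_def)
  have cm: "coefficient_map (cycle_model n) r = vec n (coeff (C r)) @\<^sub>v vec (n - 1) (coeff (D r))" for r
    using det_minor_cycle[OF m, of r, folded n_eq] reindex[of "\<lambda>x. [:r x, 1:]"]
    by (simp add: coefficient_map_def Let_def C_def D_def cycle_model_def)
  have "coefficient_map (cycle_model n) q = coefficient_map (cycle_model n) p \<longleftrightarrow>
      vec n (coeff (C q)) = vec n (coeff (C p)) \<and>
      vec (n - 1) (coeff (D q)) = vec (n - 1) (coeff (D p))"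
    unfolding cm by (rule append_vec_eq) auto
  also have "\<dots> \<longleftrightarrow> C q = C p \<and> D q = D p"
    using monic_poly_eqI[OF Cm Cm, of q p] monic_poly_eqI[OF Dm Dm, of q p] by auto
  \<comment> \<open>Once \<open>D q = D p\<close>, both characteristic polynomials are built on the
    same factor, of degree \<open>n - 1 > 0\<close>.\<close>
  also have "\<dots> \<longleftrightarrow> D q = D p \<and> q u + q v = p u + p v \<and>
      q u * (\<Prod>x\<in>T. q x) = p u * (\<Prod>x\<in>T. p x)"
    using linear_mult_minus_const_eq_iff[of "D p"] n by (auto simp: C Dm)
  finally show ?thesis by (simp add: D_def)
qed

theorem theorem6p3:
  fixes n :: nat
  assumes "n \<ge> 3"
  shows "has_identifiability_degree (cycle_model n) (fact (n - 1))"
proof -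
  let ?M = "cycle_model n"
  let ?I = "param_index ?M"
  define T where "T = cycle_edge n ` {2..n}"
  define u where "u = cycle_edge n 1"
  define v :: "nat \<times> nat" where "v = (0, 1)"
  have T: "finite T" "card T = n - 1"
    by (auto simp: T_def card_image inj_cycle_edge)
  have I: "?I = insert u (insert v T)"
    using param_index_cycle[of n] assms by (simp add: T_def u_def v_def)
  have uv: "u \<noteq> v" "u \<notin> T" "v \<notin> T"
    by (auto simp: u_def v_def T_def cycle_edge_def cycle_target_def split: if_splits)
  have comp[measurable]: "(\<lambda>p. p x) \<in> borel_measurable (\<Pi>\<^sub>M i\<in>?I. lborel)" if "x \<in> T" for x
    using measurable_component_singleton[of x ?I "\<lambda>i. lborel :: real measure"] that by (simp add: I)
  have "AE p in param_measure ?M. p x \<noteq> 0" if "x \<in> T" for x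
    unfolding param_measure_def using that T(1) by (intro AE_component_neq) (auto simp: I)
  moreover have "AE p in param_measure ?M. p x \<noteq> p y" if "x \<in> T" "y \<in> T" "x \<noteq> y" for x y
    unfolding param_measure_def using that T(1) comp[of y]
    \<comment> \<open>Updating coordinate \<open>x\<close> leaves \<open>p y\<close> unchanged
      because \<open>x \<noteq> y\<close>.\<close>
    by (intro AE_component_neq[where f = "\<lambda>p. p y"]) (simp_all add: I)
  ultimately have "AE p in param_measure ?M. (\<forall>x\<in>T. p x \<noteq> 0) \<and> (\<forall>x\<in>T. \<forall>y\<in>T. x \<noteq> y \<longrightarrow> p x \<noteq> p y)"
    using T(1) by (auto intro!: AE_finite_allI)
  then have "AE p in param_measure ?M.
      let fibre = {q \<in> ?I \<rightarrow>\<^sub>E UNIV. coefficient_map ?M q = coefficient_map ?M p}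
      in finite fibre \<and> card fibre = fact (n - 1)"
  proof (rule AE_mp, intro AE_I2 impI)
    fix p :: "nat \<times> nat \<Rightarrow> real"
    assume *: "(\<forall>x\<in>T. p x \<noteq> 0) \<and> (\<forall>x\<in>T. \<forall>y\<in>T. x \<noteq> y \<longrightarrow> p x \<noteq> p y)"
    then have "inj_on p T" "(\<Prod>x\<in>T. p x) \<noteq> 0"
      using T(1) by (auto simp: inj_on_def)
    from card_fibre[OF T(1) uv I this]
    show "let fibre = {q \<in> ?I \<rightarrow>\<^sub>E UNIV. coefficient_map ?M q = coefficient_map ?M p}
      in finite fibre \<and> card fibre = fact (n - 1)"
      using coefficient_map_cycle_eq_iff[OF assms, of _ p] T(2)
      by (simp add: T_def u_def v_def)
  qed
  moreover have "valid_model ?M" "inputs ?M = {1}" "outputs ?M = {1}"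
    using assms by (auto simp: valid_model_def cycle_model_def irrefl_def)
  ultimately show ?thesis by (simp add: has_identifiability_degree_def)
qed

end
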